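(* Assume the weak approximation property holds with constant $\eta_w>0$: for every $\mathbf v\in\mathbb R^n$ there is $\mathbf v_c\in\mathbb R^{n_c}$ with $\|\mathbf v-P\mathbf v_c\|_D\le\eta_w\|\mathbf v\|_A$. Then there is a constant $\eta_s\le\|D\|\,\|D^{-1}\|\,\eta_w^2$ such that for every $\mathbf u\in\mathbb R^n$, with $\overline{\mathbf u}_c=(I-\pi_f)P\mathbf u_c$ where $\mathbf u_c\in\mathbb R^{n_c}$ solves $$P^T(I-\pi_f)^TA(I-\pi_f)P\,\mathbf u_c=P^T(I-\pi_f)^TA\mathbf u,$$ one has $$\|A\|\,\|\mathbf u-\overline{\mathbf u}_c\|_A^2\le\|D\|\,\|\mathbf u-\overline{\mathbf u}_c\|_A^2\le\eta_s\,\|A\mathbf u\|^2.$$ In particular, if $D$ is well-conditioned, meaning $\|D\|\,\|D^{-1}\|\le K$, then $\eta_s\le K\eta_w^2$.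
   Context: $A\in\mathbb R^{n\times n}$ is symmetric positive definite (SPD), and $D\in\mathbb R^{n\times n}$ is a diagonal SPD matrix with $\mathbf v^TA\mathbf v\le\mathbf v^TD\mathbf v$ for all $\mathbf v\in\mathbb R^n$. For an SPD matrix $B$, $\|\mathbf v\|_B=\sqrt{\mathbf v^TB\mathbf v}$; $\|\cdot\|$ is the Euclidean norm for vectors and the spectral norm for matrices. The index set $\{1,\dots,n\}$ is partitioned into nonoverlapping aggregates $\mathcal A_1,\dots,\mathcal A_{n_a}$. The prolongation $P\in\mathbb R^{n\times n_c}$, of full column rank with $1\le n_c<n$, is block diagonal with respect to this partition, with blocks $P_{\mathcal A_i}$ (rows indexed by $\mathcal A_i$). On each aggregate, let $D_{\mathcal A_i}=D|_{\mathcal A_i}$ and choose vectors that are orthonormal with respect to $D_{\mathcal A_i}$ and span the $D_{\mathcal A_i}$-orthogonal complement of $\operatorname{Range}(P_{\mathcal A_i})$. Extended by zero outside $\mathcal A_i$, these vectors (for all $i$) are the columns of $P_\perp\in\mathbb R^{n\times(n-n_c)}$. Thus $P_\perp^TDP=0$ and $P_\perp^TDP_\perp=I$. Define $A_f=P_\perp^TAP_\perp$ and $\pi_f=P_\perp A_f^{-1}P_\perp^TA$. *)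

theory Defs
  imports "HOL-Analysis.Analysis" "HOL-Library.Disjoint_Sets"
begin

definition spd :: "real^'n^'n \<Rightarrow> bool" where
  "spd B \<longleftrightarrow> transpose B = B \<and> (\<forall>v. v \<noteq> 0 \<longrightarrow> 0 < v \<bullet> (B *v v))"

definition is_diagonal :: "real^'n^'n \<Rightarrow> bool" where
  "is_diagonal B \<longleftrightarrow> (\<forall>i j. i \<noteq> j \<longrightarrow> B $ i $ j = 0)"

definition energy_norm :: "real^'n^'n \<Rightarrow> real^'n \<Rightarrow> real" where
  "energy_norm B v = sqrt (v \<bullet> (B *v v))"

(* The class instance norm on real^'n^'m is the Frobenius norm, not the spectral norm. *)
definition spectral_norm :: "real^'n^'m \<Rightarrow> real" where
  "spectral_norm M = onorm (\<lambda>v. M *v v)"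

(* The block of M with row set R and column set C, kept in the ambient space by filling up
   with zeros: real^'c^'n has no type for submatrices over arbitrary index subsets. *)
definition block :: "'n set \<Rightarrow> 'c set \<Rightarrow> real^'c^'n \<Rightarrow> real^'c^'n" where
  "block R C M = (\<chi> i j. if i \<in> R \<and> j \<in> C then M $ i $ j else 0)"

(* The map c sends each column to the aggregate whose diagonal block contains it. *)
definition block_diagonal :: "'n set set \<Rightarrow> ('c \<Rightarrow> 'n set) \<Rightarrow> real^'c^'n \<Rightarrow> bool" where
  "block_diagonal \<A> c M \<longleftrightarrow> (\<forall>j. c j \<in> \<A>) \<and> (\<forall>i j. i \<notin> c j \<longrightarrow> M $ i $ j = 0)"

(* Vectors on the aggregate S, extended by zero, that are orthogonal to the range of the
   block of P on S in the inner product given by the block of D on S. *)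
definition local_complement ::
    "real^'n^'n \<Rightarrow> ('c \<Rightarrow> 'n set) \<Rightarrow> real^'c^'n \<Rightarrow> 'n set \<Rightarrow> (real^'n) set" where
  "local_complement D c P S =
     {v. (\<forall>i. i \<notin> S \<longrightarrow> v $ i = 0) \<and>
         (\<forall>w. v \<bullet> (block S S D *v (block S {j. c j = S} P *v w)) = 0)}"

definition aggregate_complement_basis ::
    "real^'n^'n \<Rightarrow> 'n set set \<Rightarrow> ('c \<Rightarrow> 'n set) \<Rightarrow> real^'c^'n \<Rightarrow>
     ('f \<Rightarrow> 'n set) \<Rightarrow> real^'f^'n \<Rightarrow> bool" where
  "aggregate_complement_basis D \<A> c P f Q \<longleftrightarrow>
     block_diagonal \<A> f Q \<and>
     (\<forall>S\<in>\<A>.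
        (\<forall>j k. f j = S \<longrightarrow> f k = S \<longrightarrow>
           column j Q \<bullet> (block S S D *v column k Q) = (if j = k then 1 else 0)) \<and>
        span {column j Q | j. f j = S} = local_complement D c P S)"

definition fine_matrix :: "real^'n^'n \<Rightarrow> real^'f^'n \<Rightarrow> real^'f^'f" where
  "fine_matrix A Q = transpose Q ** A ** Q"

definition fine_projection :: "real^'n^'n \<Rightarrow> real^'f^'n \<Rightarrow> real^'n^'n" where
  "fine_projection A Q = Q ** matrix_inv (fine_matrix A Q) ** transpose Q ** A"

definition weak_approximation :: "real^'n^'n \<Rightarrow> real^'n^'n \<Rightarrow> real^'c^'n \<Rightarrow> real \<Rightarrow> bool" where
  "weak_approximation A D P \<eta> \<longleftrightarrow>
     (\<forall>v. \<exists>vc. energy_norm D (v - P *v vc) \<le> \<eta> * energy_norm A v)"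

end

theory Submission
  imports Defs
begin

text \<open>
  Write \<open>Q\<close> for \<open>P_perp\<close>. The fine space \<open>range Q\<close> is the \<open>D\<close>-orthogonal complement of the coarse
  space \<open>range P\<close>, and \<open>I - \<pi>\<^sub>f\<close> replaces the coarse space by the \<open>A\<close>-orthogonal complement of the
  fine space. The coarse equation makes the error \<open>e = u - ubar\<close> \<open>A\<close>-orthogonal to that complement,
  so \<open>e\<close> lies in the fine space (\<open>galerkin_error_in_fine_space\<close>). This has two consequences.

  \<^item> As \<open>e\<close> is \<open>D\<close>-orthogonal to \<open>range P\<close>, the best coarse approximation of \<open>e\<close> in the norm of \<open>D\<close>
    is zero, and the weak approximation property reads \<open>\<parallel>e\<parallel>\<^sub>D \<le> \<eta>\<^sub>w \<parallel>e\<parallel>\<^sub>A\<close>.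
  \<^item> As \<open>ubar\<close> is \<open>A\<close>-orthogonal to the fine space, \<open>\<parallel>e\<parallel>\<^sub>A\<^sup>2 = e \<bullet> A u \<le> \<parallel>e\<parallel> \<parallel>A u\<parallel>\<close>.

  Since \<open>\<parallel>e\<parallel>\<^sup>2 \<le> \<parallel>D\<inverse>\<parallel> \<parallel>e\<parallel>\<^sub>D\<^sup>2\<close>, together they give \<open>\<parallel>e\<parallel>\<^sub>A\<^sup>2 \<le> \<parallel>D\<inverse>\<parallel> \<eta>\<^sub>w\<^sup>2 \<parallel>A u\<parallel>\<^sup>2\<close>, and one may take
  \<open>\<eta>\<^sub>s = \<parallel>D\<parallel> \<parallel>D\<inverse>\<parallel> \<eta>\<^sub>w\<^sup>2\<close>. The comparison of the spectral norms of \<open>A\<close> and \<open>D\<close> and the bound by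
  \<open>\<parallel>D\<inverse>\<parallel>\<close> both come from the Cauchy-Schwarz inequality for the form of an SPD matrix, without
  diagonalisation.
\<close>

section \<open>Symmetric positive definite matrices\<close>

lemma inner_matrix_vector_transpose:
  fixes M :: "real^'m^'n"
  shows "x \<bullet> (M *v y) = (transpose M *v x) \<bullet> y"
  by (simp add: dot_lmul_matrix)

lemma spd_inner_commute:
  assumes "spd B"
  shows "x \<bullet> (B *v y) = (B *v x) \<bullet> y"
  using assms by (simp add: spd_def inner_matrix_vector_transpose del: transpose_matrix_vector)

lemma spd_nonneg:
  assumes "spd B"
  shows "0 \<le> v \<bullet> (B *v v)"
  using assms unfolding spd_def by (cases "v = 0") (auto intro: less_imp_le)

lemma spd_eq_0_iff:
  assumes "spd B"
  shows "v \<bullet> (B *v v) = 0 \<longleftrightarrow> v = 0"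
  using assms unfolding spd_def by (cases "v = 0") (auto dest: spec[of _ v])

lemma energy_norm_sq:
  assumes "spd B"
  shows "(energy_norm B v)\<^sup>2 = v \<bullet> (B *v v)"
  using spd_nonneg[OF assms] by (simp add: energy_norm_def)

lemma spd_cauchy_schwarz:
  assumes B: "spd B"
  shows "(v \<bullet> (B *v w))\<^sup>2 \<le> (v \<bullet> (B *v v)) * (w \<bullet> (B *v w))"
proof (cases "w = 0")
  case False
  define a b c where abc: "a = v \<bullet> (B *v v)" "b = v \<bullet> (B *v w)" "c = w \<bullet> (B *v w)"
  have c: "c > 0" using B False by (simp add: spd_def abc)
  have b: "w \<bullet> (B *v v) = b"
    using spd_inner_commute[OF B, of w v] by (simp add: abc inner_commute)
  \<comment> \<open>Up to the factor \<open>c\<close>, this vector is the component of \<open>v\<close> that is \<open>B\<close>-orthogonal to \<open>w\<close>.\<close>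
  define x where "x = c *\<^sub>R v - b *\<^sub>R w"
  have "x \<bullet> (B *v x) = c * (c * a - b * b)"
    unfolding x_def matrix_vector_mult_diff_distrib matrix_vector_mult_scaleR
    by (simp add: inner_diff_left inner_diff_right b algebra_simps flip: abc)
  with spd_nonneg[OF B, of x] c have "b * b \<le> c * a"
    by (simp add: zero_le_mult_iff)
  then show ?thesis by (simp add: power2_eq_square mult.commute flip: abc)
qed simp

lemma spd_invertible:
  assumes "spd B"
  shows "invertible B"
proof -
  have "x = 0" if "B *v x = 0" for x
    using that spd_eq_0_iff[OF assms, of x] by simp
  then show ?thesis
    using invertible_left_inverse matrix_left_invertible_ker by blast
qed

lemma invertible_mult_matrix_inv:
  fixes M :: "real^'n^'n"
  assumes "invertible M"
  shows "M ** matrix_inv M = mat 1"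
  using someI_ex[OF assms[unfolded invertible_def]] by (simp add: matrix_inv_def)

lemma norm_le_spectral_norm:
  fixes M :: "real^'m^'n"
  shows "norm (M *v v) \<le> spectral_norm M * norm v"
  unfolding spectral_norm_def by (rule onorm) (rule matrix_vector_mul_bounded_linear)

lemma spectral_norm_nonneg:
  fixes M :: "real^'m^'n"
  shows "0 \<le> spectral_norm M"
  unfolding spectral_norm_def by (rule onorm_pos_le) (rule matrix_vector_mul_bounded_linear)

lemma inner_le_spectral_norm:
  fixes M :: "real^'n^'n"
  shows "v \<bullet> (M *v v) \<le> spectral_norm M * (norm v)\<^sup>2"
proof -
  have "v \<bullet> (M *v v) \<le> norm v * norm (M *v v)" by (rule norm_cauchy_schwarz)
  also have "\<dots> \<le> norm v * (spectral_norm M * norm v)"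
    by (intro mult_left_mono norm_le_spectral_norm) simp
  finally show ?thesis by (simp add: power2_eq_square mult_ac)
qed

text \<open>
  The Cauchy-Schwarz inequality for the form of \<open>A\<close>, applied to \<open>A v\<close> and \<open>v\<close>, bounds
  \<open>\<parallel>A v\<parallel>\<^sup>4\<close> by a product of two values of the form of \<open>A\<close>, and each of these is at most the
  corresponding value of the form of \<open>D\<close>.
\<close>

lemma spectral_norm_mono:
  assumes A: "spd A" and le: "\<And>v. v \<bullet> (A *v v) \<le> v \<bullet> (D *v v)"
  shows "spectral_norm A \<le> spectral_norm D"
proof -
  have "norm (A *v v) \<le> spectral_norm D * norm v" for v
  proof (cases "A *v v = 0")
    case True
    then show ?thesis by (simp add: spectral_norm_nonneg)
  next
    case False
    define w where "w = A *v v"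
    let ?s = "spectral_norm D"
    have form_le: "x \<bullet> (A *v x) \<le> ?s * (norm x)\<^sup>2" for x
      using le[of x] inner_le_spectral_norm[of x D] by linarith
    have "((norm w)\<^sup>2)\<^sup>2 = (w \<bullet> (A *v v))\<^sup>2"
      by (simp add: w_def power2_norm_eq_inner)
    also have "\<dots> \<le> (w \<bullet> (A *v w)) * (v \<bullet> (A *v v))"
      by (rule spd_cauchy_schwarz[OF A])
    also have "\<dots> \<le> (?s * (norm w)\<^sup>2) * (?s * (norm v)\<^sup>2)"
      by (intro mult_mono form_le spd_nonneg[OF A] mult_nonneg_nonneg spectral_norm_nonneg) simp
    finally have "(norm w)\<^sup>2 * (norm w)\<^sup>2 \<le> (norm w)\<^sup>2 * (?s * norm v)\<^sup>2"
      by (simp add: power2_eq_square mult_ac)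
    with False have "(norm w)\<^sup>2 \<le> (?s * norm v)\<^sup>2"
      unfolding w_def by (subst (asm) mult_le_cancel_left_pos) auto
    then show ?thesis
      unfolding w_def by (rule power2_le_imp_le) (simp add: spectral_norm_nonneg)
  qed
  then show ?thesis
    unfolding spectral_norm_def[of A] by (rule onorm_le)
qed

text \<open>
  The Cauchy-Schwarz inequality for the form of \<open>D\<close> is applied to \<open>D\<inverse> e\<close> and \<open>e\<close>, whose product in
  that form is \<open>\<parallel>e\<parallel>\<^sup>2\<close>. This stands in for the bound \<open>1 / \<parallel>D\<inverse>\<parallel>\<close> on the smallest eigenvalue of \<open>D\<close>.
\<close>

lemma norm_sq_le_spectral_norm_inv:
  assumes D: "spd D"
  shows "(norm e)\<^sup>2 \<le> spectral_norm (matrix_inv D) * (e \<bullet> (D *v e))"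
proof (cases "e = 0")
  case False
  define g where "g = matrix_inv D *v e"
  have g: "D *v g = e"
    by (simp add: g_def matrix_vector_mul_assoc invertible_mult_matrix_inv[OF spd_invertible[OF D]])
  have "(norm e)\<^sup>2 * (norm e)\<^sup>2 = (g \<bullet> (D *v e))\<^sup>2"
    by (simp add: spd_inner_commute[OF D, of g] g flip: power2_norm_eq_inner power2_eq_square)
  also have "\<dots> \<le> (g \<bullet> (D *v g)) * (e \<bullet> (D *v e))"
    by (rule spd_cauchy_schwarz[OF D])
  also have "\<dots> = (e \<bullet> (matrix_inv D *v e)) * (e \<bullet> (D *v e))"
    by (simp add: g) (simp add: g_def inner_commute)
  also have "\<dots> \<le> (spectral_norm (matrix_inv D) * (norm e)\<^sup>2) * (e \<bullet> (D *v e))"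
    by (intro mult_right_mono inner_le_spectral_norm spd_nonneg[OF D])
  finally have "(norm e)\<^sup>2 * (norm e)\<^sup>2
      \<le> (norm e)\<^sup>2 * (spectral_norm (matrix_inv D) * (e \<bullet> (D *v e)))"
    by (simp add: mult_ac)
  with False show ?thesis by (subst (asm) mult_le_cancel_left_pos) auto
qed simp

section \<open>From aggregates to global orthogonality\<close>

lemma diagonal_matrix_vector_nth:
  assumes "is_diagonal D"
  shows "(D *v w) $ i = D $ i $ i * w $ i"
proof -
  have "(D *v w) $ i = (\<Sum>j\<in>UNIV. if j = i then D $ i $ i * w $ i else 0)"
    unfolding matrix_vector_mult_def vec_lambda_beta
    by (rule sum.cong) (use assms in \<open>auto simp: is_diagonal_def\<close>)
  then show ?thesis by simp
qed

lemma diagonal_block_nth: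
  assumes "is_diagonal D"
  shows "(block S S D *v w) $ i = (if i \<in> S then D $ i $ i * w $ i else 0)"
proof -
  have "is_diagonal (block S S D)"
    using assms by (simp add: is_diagonal_def block_def)
  then show ?thesis
    by (simp add: diagonal_matrix_vector_nth) (simp add: block_def)
qed

text \<open>
  Because the aggregates are disjoint, a row of a block diagonal matrix meets only the columns of
  the aggregate that contains the row.
\<close>

lemma block_diagonal_nth:
  assumes part: "partition_on UNIV \<A>" and P: "block_diagonal \<A> c P" and S: "S \<in> \<A>" "i \<in> S"
  shows "(block S {j. c j = S} P *v w) $ i = (P *v w) $ i"
proof -
  have "P $ i $ j = 0" if "c j \<noteq> S" for j
  proof -
    have "c j \<inter> S = {}"
      using disjointD[OF partition_onD2[OF part], of "c j" S] P S that
      by (simp add: block_diagonal_def)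
    with S P show ?thesis by (auto simp: block_diagonal_def)
  qed
  then show ?thesis
    unfolding matrix_vector_mult_def vec_lambda_beta block_def using S
    by (intro sum.cong) auto
qed

lemma transpose_mult_nth:
  fixes Q :: "real^'f^'n"
  shows "(transpose Q *v x) $ j = column j Q \<bullet> x"
  by (simp add: matrix_vector_mult_def transpose_def column_def inner_vec_def)

lemma complement_orthogonal_coarse:
  assumes D: "is_diagonal D" and part: "partition_on UNIV \<A>" and P: "block_diagonal \<A> c P"
    and Q: "aggregate_complement_basis D \<A> c P f Q"
  shows "transpose Q *v (D *v (P *v w)) = 0"
proof -
  have "column j Q \<bullet> (D *v (P *v w)) = 0" for j
  proof -
    let ?S = "f j"
    have S: "?S \<in> \<A>" and supp: "\<And>i. i \<notin> ?S \<Longrightarrow> column j Q $ i = 0"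
      using Q by (auto simp: aggregate_complement_basis_def block_diagonal_def column_def)
    have "column j Q \<in> span {column k Q | k. f k = ?S}"
      by (rule span_base) auto
    then have "column j Q \<in> local_complement D c P ?S"
      using Q S by (auto simp: aggregate_complement_basis_def)
    then have "column j Q \<bullet> (block ?S ?S D *v (block ?S {k. c k = ?S} P *v w)) = 0"
      by (auto simp: local_complement_def)
    also have "column j Q \<bullet> (block ?S ?S D *v (block ?S {k. c k = ?S} P *v w))
        = column j Q \<bullet> (D *v (P *v w))"
      unfolding inner_vec_def
      by (intro sum.cong refl)
        (use supp in \<open>auto simp: diagonal_block_nth[OF D] diagonal_matrix_vector_nth[OF D]
            block_diagonal_nth[OF part P S]\<close>)
    finally show ?thesis .
  qed
  then show ?thesis by (simp add: vec_eq_iff transpose_mult_nth del: transpose_matrix_vector)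
qed

lemma complement_orthonormal:
  assumes D: "is_diagonal D" and part: "partition_on UNIV \<A>"
    and Q: "aggregate_complement_basis D \<A> c P f Q"
  shows "transpose Q ** D ** Q = mat 1"
proof -
  have entry: "column j Q \<bullet> (D *v column k Q) = (if j = k then 1 else 0)" for j k
  proof -
    have S: "f j \<in> \<A>" "f k \<in> \<A>"
      and supp: "\<And>i l. i \<notin> f l \<Longrightarrow> column l Q $ i = 0"
      using Q by (auto simp: aggregate_complement_basis_def block_diagonal_def column_def)
    show ?thesis
    proof (cases "f j = f k")
      case True
      have "column j Q \<bullet> (D *v column k Q) = column j Q \<bullet> (block (f j) (f j) D *v column k Q)"
        unfolding inner_vec_def
        by (intro sum.cong refl)
          (use supp in \<open>auto simp: diagonal_block_nth[OF D] diagonal_matrix_vector_nth[OF D]\<close>)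
      then show ?thesis
        using Q S True by (auto simp: aggregate_complement_basis_def)
    next
      case False
      then have "f j \<inter> f k = {}"
        using disjointD[OF partition_onD2[OF part]] S by blast
      then have "column j Q $ i = 0 \<or> column k Q $ i = 0" for i
        using supp by blast
      then have "column j Q \<bullet> (D *v column k Q) = 0"
        unfolding inner_vec_def
        by (intro sum.neutral ballI) (auto simp: diagonal_matrix_vector_nth[OF D])
      with False show ?thesis by auto
    qed
  qed
  have "(transpose Q ** (D ** Q)) $ j $ k = column j Q \<bullet> (D *v column k Q)" for j k
    by (simp add: matrix_matrix_mult_def transpose_def column_def inner_vec_def
        matrix_vector_mult_def)
  then show ?thesis
    by (simp add: vec_eq_iff entry mat_def matrix_mul_assoc[symmetric])
qed

text \<open>
  Independence of the two ranges follows from \<open>D\<close>-orthogonality, and the dimensions add up.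
\<close>

lemma coarse_fine_decomposition:
  fixes P :: "real^'c^'n" and Q :: "real^'f^'n"
  assumes QDP: "\<And>w. transpose Q *v (D *v (P *v w)) = 0"
    and QDQ: "transpose Q ** D ** Q = mat 1"
    and rank: "rank P = CARD('c)" and card: "CARD('c) + CARD('f) = CARD('n)"
  obtains a b where "v = P *v a + Q *v b"
proof -
  have QDQ': "transpose Q *v (D *v (Q *v b)) = b" for b
    using QDQ by (simp add: matrix_vector_mul_assoc matrix_mul_assoc del: transpose_matrix_vector)
  let ?U = "range ((*v) P)" and ?V = "range ((*v) Q)"
  have sub: "subspace ?U" "subspace ?V"
    by (auto intro!: linear_subspace_image simp: subspace_UNIV)
  have "inj ((*v) Q)" by (rule inj_on_inverseI) (rule QDQ')
  then have "dim ?V = CARD('f)"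
    by (subst dim_image_eq) (auto simp: matrix_vector_mul_linear)
  moreover have "dim ?U = CARD('c)"
    using rank by (simp add: rank_dim_range)
  moreover have "?U \<inter> ?V = {0}"
  proof -
    have "Q *v b = 0" if "P *v a = Q *v b" for a b
    proof -
      have "b = transpose Q *v (D *v (P *v a))" unfolding that QDQ' ..
      then show ?thesis by (simp add: QDP del: transpose_matrix_vector)
    qed
    moreover have "0 \<in> ?U" "0 \<in> ?V" using sub by (auto dest: subspace_0)
    ultimately show ?thesis by fastforce
  qed
  ultimately have "dim {x + y |x y. x \<in> ?U \<and> y \<in> ?V} = CARD('n)"
    using dim_sums_Int[OF sub] card by simp
  moreover have "subspace {x + y |x y. x \<in> ?U \<and> y \<in> ?V}"
    using sub by (rule subspace_sums)
  ultimately have "{x + y |x y. x \<in> ?U \<and> y \<in> ?V} = UNIV"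
    using dim_eq_full[of "{x + y |x y. x \<in> ?U \<and> y \<in> ?V}"]
    by (simp add: span_eq_iff[THEN iffD2])
  then have "v \<in> {x + y |x y. x \<in> ?U \<and> y \<in> ?V}" by simp
  then show thesis using that by blast
qed

section \<open>The coarse correction\<close>

lemma fine_matrix_invertible:
  assumes A: "spd A" and Q: "inj ((*v) Q)"
  shows "invertible (fine_matrix A Q)"
proof -
  have "b = 0" if "fine_matrix A Q *v b = 0" for b
  proof -
    have "(Q *v b) \<bullet> (A *v (Q *v b)) = b \<bullet> (fine_matrix A Q *v b)"
      unfolding inner_commute[of "Q *v b"] inner_commute[of b]
      by (simp add: inner_matrix_vector_transpose fine_matrix_def matrix_vector_mul_assoc[symmetric]
          del: transpose_matrix_vector)
    with that have "Q *v b = Q *v 0" by (simp add: spd_eq_0_iff[OF A])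
    then show "b = 0" by (rule injD[OF Q])
  qed
  then show ?thesis
    using invertible_left_inverse matrix_left_invertible_ker by blast
qed

lemma fine_projection_orthogonal:
  assumes "invertible (fine_matrix A Q)"
  shows "transpose Q *v (A *v ((mat 1 - fine_projection A Q) *v x)) = 0"
proof -
  have "transpose Q ** A ** fine_projection A Q
      = (fine_matrix A Q ** matrix_inv (fine_matrix A Q)) ** (transpose Q ** A)"
    by (simp add: fine_projection_def fine_matrix_def matrix_mul_assoc)
  also have "\<dots> = transpose Q ** A"
    by (simp add: invertible_mult_matrix_inv[OF assms])
  finally have "transpose Q *v (A *v (fine_projection A Q *v x)) = transpose Q *v (A *v x)"
    by (simp add: matrix_vector_mul_assoc matrix_mul_assoc del: transpose_matrix_vector)
  then show ?thesis
    by (simp add: matrix_vector_mult_diff_rdistrib matrix_vector_mult_diff_distrib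
        del: transpose_matrix_vector)
qed

text \<open>
  Modulo the fine space, \<open>I - \<pi>\<^sub>f\<close> is the identity, so \<open>e = (I - \<pi>\<^sub>f) P a + Q b\<close> for some \<open>a\<close> and
  \<open>b\<close>. The first summand is \<open>A\<close>-orthogonal to \<open>e\<close> by hypothesis and to \<open>Q b\<close> by construction of
  \<open>\<pi>\<^sub>f\<close>; hence it is \<open>A\<close>-orthogonal to itself and vanishes.
\<close>

lemma galerkin_error_in_fine_space:
  assumes A: "spd A" and inv: "invertible (fine_matrix A Q)"
    and dec: "\<And>v. \<exists>a b. v = P *v a + Q *v b"
    and orth: "\<And>a. ((mat 1 - fine_projection A Q) *v (P *v a)) \<bullet> (A *v e) = 0"
  shows "\<exists>b. e = Q *v b"
proof -
  obtain a b where e: "e = P *v a + Q *v b" using dec by blast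
  define x where "x = (mat 1 - fine_projection A Q) *v (P *v a)"
  define b' where
    "b' = b + matrix_inv (fine_matrix A Q) *v (transpose Q *v (A *v (P *v a)))"
  have "fine_projection A Q *v (P *v a)
      = Q *v (matrix_inv (fine_matrix A Q) *v (transpose Q *v (A *v (P *v a))))"
    by (simp add: fine_projection_def matrix_vector_mul_assoc matrix_mul_assoc
        del: transpose_matrix_vector)
  then have e': "e = x + Q *v b'"
    by (simp add: e x_def b'_def matrix_vector_right_distrib matrix_vector_mult_diff_rdistrib
        del: transpose_matrix_vector)
  have "x \<bullet> (A *v (Q *v b')) = (transpose Q *v (A *v x)) \<bullet> b'"
    unfolding spd_inner_commute[OF A, of x] by (rule inner_matrix_vector_transpose)
  also have "\<dots> = 0"
    by (simp add: x_def fine_projection_orthogonal[OF inv] del: transpose_matrix_vector)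
  finally have "x \<bullet> (A *v x) = 0"
    using orth[of a] by (simp add: e' x_def[symmetric] matrix_vector_right_distrib
        inner_add_right)
  then have "x = 0" by (simp add: spd_eq_0_iff[OF A])
  with e' show ?thesis by auto
qed

text \<open>
  By Pythagoras in the inner product of \<open>D\<close>, the zero vector is the best approximation from
  \<open>range P\<close> to a vector of the fine space.
\<close>

lemma fine_space_energy_le:
  assumes D: "spd D" and QDP: "\<And>w. transpose Q *v (D *v (P *v w)) = 0"
    and wap: "weak_approximation A D P \<eta>"
  shows "energy_norm D (Q *v b) \<le> \<eta> * energy_norm A (Q *v b)"
proof -
  let ?e = "Q *v b"
  obtain w where w: "energy_norm D (?e - P *v w) \<le> \<eta> * energy_norm A ?e"
    using wap by (auto simp: weak_approximation_def)
  have "(P *v w) \<bullet> (D *v ?e) = (transpose Q *v (D *v (P *v w))) \<bullet> b"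
    unfolding spd_inner_commute[OF D, of "P *v w"] by (rule inner_matrix_vector_transpose)
  then have cross: "(P *v w) \<bullet> (D *v ?e) = 0"
    by (simp add: QDP del: transpose_matrix_vector)
  then have "?e \<bullet> (D *v (P *v w)) = 0"
    by (metis spd_inner_commute[OF D] inner_commute)
  with cross have "(?e - P *v w) \<bullet> (D *v (?e - P *v w))
      = ?e \<bullet> (D *v ?e) + (P *v w) \<bullet> (D *v (P *v w))"
    by (simp add: matrix_vector_mult_diff_distrib inner_diff_left inner_diff_right)
  then have "energy_norm D ?e \<le> energy_norm D (?e - P *v w)"
    using spd_nonneg[OF D, of "P *v w"] by (simp add: energy_norm_def)
  with w show ?thesis by linarith
qed

theorem corollary3p4:
  fixes A D :: "real^'n^'n"
    and P :: "real^'c^'n"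
    and P_perp :: "real^'f^'n"
    and \<A> :: "'n set set"
    and c :: "'c \<Rightarrow> 'n set"
    and f :: "'f \<Rightarrow> 'n set"
    and \<eta>\<^sub>w :: real
  assumes "spd A"
    and "spd D" and "is_diagonal D"
    and "\<And>v. v \<bullet> (A *v v) \<le> v \<bullet> (D *v v)"
    and "partition_on UNIV \<A>"
    and "CARD('c) < CARD('n)"
    and "CARD('f) = CARD('n) - CARD('c)"
    and "rank P = CARD('c)"
    and "block_diagonal \<A> c P"
    and "aggregate_complement_basis D \<A> c P f P_perp"
    and "\<eta>\<^sub>w > 0"
    and "weak_approximation A D P \<eta>\<^sub>w"
  shows "\<exists>\<eta>\<^sub>s. \<eta>\<^sub>s \<le> spectral_norm D * spectral_norm (matrix_inv D) * \<eta>\<^sub>w\<^sup>2 \<and>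
    (\<forall>u uc ubar.
       (transpose P ** transpose (mat 1 - fine_projection A P_perp) ** A **
          (mat 1 - fine_projection A P_perp) ** P) *v uc =
       (transpose P ** transpose (mat 1 - fine_projection A P_perp) ** A) *v u \<longrightarrow>
       ubar = ((mat 1 - fine_projection A P_perp) ** P) *v uc \<longrightarrow>
         spectral_norm A * (energy_norm A (u - ubar))\<^sup>2
           \<le> spectral_norm D * (energy_norm A (u - ubar))\<^sup>2 \<and>
         spectral_norm D * (energy_norm A (u - ubar))\<^sup>2 \<le> \<eta>\<^sub>s * (norm (A *v u))\<^sup>2) \<and>
    (\<forall>K. spectral_norm D * spectral_norm (matrix_inv D) \<le> K \<longrightarrow> \<eta>\<^sub>s \<le> K * \<eta>\<^sub>w\<^sup>2)"
proof -
  let ?Q = P_perp and ?T = "mat 1 - fine_projection A P_perp"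
  note QDP = complement_orthogonal_coarse[OF assms(3,5,9,10)]
  note QDQ = complement_orthonormal[OF assms(3,5,10)]
  have "transpose ?Q *v (D *v (?Q *v b)) = b" for b
    using QDQ by (simp add: matrix_vector_mul_assoc matrix_mul_assoc del: transpose_matrix_vector)
  then have "inj ((*v) ?Q)" by (rule inj_on_inverseI)
  note inv = fine_matrix_invertible[OF assms(1) this]
  have card: "CARD('c) + CARD('f) = CARD('n)" using assms(6,7) by simp
  have dec: "\<exists>a b. v = P *v a + ?Q *v b" for v
    using coarse_fine_decomposition[OF QDP QDQ assms(8) card] by metis
  let ?d = "spectral_norm (matrix_inv D)"
  have bound: "(energy_norm A (u - ubar))\<^sup>2 \<le> ?d * \<eta>\<^sub>w\<^sup>2 * (norm (A *v u))\<^sup>2"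
    if eq: "(transpose P ** transpose ?T ** A ** ?T ** P) *v uc
          = (transpose P ** transpose ?T ** A) *v u"
      and ubar: "ubar = (?T ** P) *v uc" for u uc ubar
  proof -
    define e where "e = u - ubar"
    have "transpose P *v (transpose ?T *v (A *v e)) = 0"
      using eq by (simp add: e_def ubar matrix_vector_mult_diff_distrib matrix_vector_mul_assoc
          matrix_mul_assoc del: transpose_matrix_vector)
    then have "(?T *v (P *v a)) \<bullet> (A *v e) = 0" for a
      unfolding inner_commute[of _ "A *v e"]
      by (simp add: inner_matrix_vector_transpose del: transpose_matrix_vector)
    from galerkin_error_in_fine_space[OF assms(1) inv dec this]
    obtain b where e: "e = ?Q *v b" by blast
    define E where "E = (energy_norm A e)\<^sup>2"
    have "e \<bullet> (A *v ubar) = b \<bullet> (transpose ?Q *v (A *v ubar))"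
      unfolding e inner_commute[of "?Q *v b"] inner_commute[of b]
      by (simp add: inner_matrix_vector_transpose del: transpose_matrix_vector)
    also have "\<dots> = 0"
      using fine_projection_orthogonal[OF inv, of "P *v uc"]
      by (simp add: ubar matrix_vector_mul_assoc del: transpose_matrix_vector)
    finally have "e \<bullet> (A *v e) = e \<bullet> (A *v u)"
      by (simp add: e_def matrix_vector_mult_diff_distrib inner_diff_right)
    then have "E \<le> norm e * norm (A *v u)"
      by (simp add: E_def energy_norm_sq[OF assms(1)] norm_cauchy_schwarz)
    then have 1: "E\<^sup>2 \<le> (norm e)\<^sup>2 * (norm (A *v u))\<^sup>2"
      using power_mono[of E "norm e * norm (A *v u)" 2]
      by (simp only: E_def zero_le_power2 power_mult_distrib)
    have "(energy_norm D e)\<^sup>2 \<le> (\<eta>\<^sub>w * energy_norm A e)\<^sup>2"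
      unfolding e
      by (intro power_mono fine_space_energy_le[OF assms(2) QDP assms(12)])
        (simp add: energy_norm_def spd_nonneg[OF assms(2)])
    then have "e \<bullet> (D *v e) \<le> \<eta>\<^sub>w\<^sup>2 * E"
      by (simp add: E_def energy_norm_sq[OF assms(2)] power_mult_distrib)
    then have "?d * (e \<bullet> (D *v e)) \<le> ?d * (\<eta>\<^sub>w\<^sup>2 * E)"
      by (intro mult_left_mono spectral_norm_nonneg)
    with norm_sq_le_spectral_norm_inv[OF assms(2), of e]
    have "(norm e)\<^sup>2 \<le> ?d * \<eta>\<^sub>w\<^sup>2 * E" by simp
    then have "(norm e)\<^sup>2 * (norm (A *v u))\<^sup>2 \<le> ?d * \<eta>\<^sub>w\<^sup>2 * E * (norm (A *v u))\<^sup>2"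
      by (rule mult_right_mono) simp
    with 1 have "E * E \<le> E * (?d * \<eta>\<^sub>w\<^sup>2 * (norm (A *v u))\<^sup>2)"
      by (simp add: power2_eq_square mult_ac)
    moreover have "0 \<le> E" by (simp add: E_def)
    moreover have "0 \<le> ?d * \<eta>\<^sub>w\<^sup>2 * (norm (A *v u))\<^sup>2" by (simp add: spectral_norm_nonneg)
    ultimately have "E \<le> ?d * \<eta>\<^sub>w\<^sup>2 * (norm (A *v u))\<^sup>2"
      by (cases "E = 0") auto
    then show ?thesis by (simp add: E_def e_def)
  qed
  show ?thesis
  proof (intro exI[of _ "spectral_norm D * ?d * \<eta>\<^sub>w\<^sup>2"] conjI allI impI)
    fix u ubar
    show "spectral_norm A * (energy_norm A (u - ubar))\<^sup>2
        \<le> spectral_norm D * (energy_norm A (u - ubar))\<^sup>2"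
      by (intro mult_right_mono spectral_norm_mono assms(1,4)) simp
  next
    fix u uc ubar
    assume "(transpose P ** transpose ?T ** A ** ?T ** P) *v uc
        = (transpose P ** transpose ?T ** A) *v u"
      and "ubar = (?T ** P) *v uc"
    from mult_left_mono[OF bound[OF this] spectral_norm_nonneg[of D]]
    show "spectral_norm D * (energy_norm A (u - ubar))\<^sup>2
        \<le> spectral_norm D * ?d * \<eta>\<^sub>w\<^sup>2 * (norm (A *v u))\<^sup>2"
      by (simp add: mult_ac)
  qed (auto intro: mult_right_mono)
qed

end
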